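(* Let $A=(A_1,\dots,A_g)\in M_d(\Bbbk)^g$ be a tuple of jointly nilpotent matrices. If $\mathcal{S}\subseteq\Bbbk^d$ is an invariant subspace of a non-degenerate right rank-one perturbation of $A$, then there exists a subspace $\mathcal{S}^\times\subseteq\Bbbk^d$ that is complementary to $\mathcal{S}$ (i.e., $\Bbbk^d=\mathcal{S}\oplus\mathcal{S}^\times$ as an internal direct sum) and invariant under $A_1,\dots,A_g$.
   Context: $\Bbbk$ is an algebraically closed field of characteristic $0$. Matrices $A_1,\dots,A_g\in M_d(\Bbbk)$ are jointly nilpotent if there is $N$ such that every product of $N$ of them (with repetitions) is zero; equivalently, they are simultaneously conjugate to strictly upper triangular matrices. A tuple $A'=(A_1',\dots,A_g')$ is a non-degenerate right rank-one perturbation of $A$ if there are $b_1,\dots,b_g,c\in\Bbbk^d$ with $A_j'=A_j+b_jc^{\mathrm t}$ for all $j$, such that $\{b_1,\dots,b_g\}$ is not contained in a proper subspace of $\Bbbk^d$ invariant under $A_1,\dots,A_g$, and $c$ does not lie in a proper subspace of $\Bbbk^d$ invariant under $A_1^{\mathrm t},\dots,A_g^{\mathrm t}$. An invariant subspace of a tuple is a subspace invariant under each matrix of the tuple. *)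

theory Defs
  imports "HOL-Analysis.Analysis"
begin

text \<open>
  A tuple \<open>A\<^sub>1, \<dots>, A\<^sub>g\<close> of \<open>d \<times> d\<close> matrices is a function from a finite index type
  \<open>'g\<close> with \<open>CARD('g) = g\<close> to \<open>'k ^ 'd ^ 'd\<close> with \<open>CARD('d) = d\<close>; hence \<open>g, d \<ge> 1\<close>.
  The constant \<open>vec.subspace\<close> is used for subspaces, since plain \<open>subspace\<close> is about real
  vector spaces only.
\<close>

definition word_product :: "('g \<Rightarrow> 'k::field ^ 'd ^ 'd) \<Rightarrow> 'g list \<Rightarrow> 'k ^ 'd ^ 'd"
  where "word_product A w = foldr (\<lambda>j M. A j ** M) w (mat 1)"

definition jointly_nilpotent :: "('g::finite \<Rightarrow> 'k::field ^ 'd ^ 'd) \<Rightarrow> bool"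
  where "jointly_nilpotent A \<longleftrightarrow> (\<exists>N. \<forall>w. length w = N \<longrightarrow> word_product A w = 0)"

definition invariant_subspace :: "('g::finite \<Rightarrow> 'k::field ^ 'd ^ 'd) \<Rightarrow> ('k ^ 'd) set \<Rightarrow> bool"
  where "invariant_subspace A S \<longleftrightarrow> vec.subspace S \<and> (\<forall>j. \<forall>v\<in>S. A j *v v \<in> S)"

text \<open>The matrix \<open>b c\<^sup>t\<close>, with \<open>b\<close> and \<open>c\<close> viewed as columns.\<close>

definition outer_product :: "'k::field ^ 'd \<Rightarrow> 'k ^ 'd \<Rightarrow> 'k ^ 'd ^ 'd"
  where "outer_product b c = (columnvector b :: 'k ^ 1 ^ 'd) ** (rowvector c :: 'k ^ 'd ^ 1)"

definition nondegenerate_right_rank_one_perturbation ::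
    "('g::finite \<Rightarrow> 'k::field ^ 'd ^ 'd) \<Rightarrow> ('g \<Rightarrow> 'k ^ 'd ^ 'd) \<Rightarrow> bool"
  where "nondegenerate_right_rank_one_perturbation A A' \<longleftrightarrow>
    (\<exists>b c. (\<forall>j. A' j = A j + outer_product (b j) c) \<and>
           \<not> (\<exists>T. invariant_subspace A T \<and> T \<noteq> UNIV \<and> range b \<subseteq> T) \<and>
           \<not> (\<exists>T. invariant_subspace (\<lambda>j. transpose (A j)) T \<and> T \<noteq> UNIV \<and> c \<in> T))"

definition complementary_subspaces :: "('k::field ^ 'd) set \<Rightarrow> ('k ^ 'd) set \<Rightarrow> bool"
  where "complementary_subspaces S T \<longleftrightarrow>
    vec.subspace S \<and> vec.subspace T \<and> S \<inter> T = {0} \<and> {x + y | x y. x \<in> S \<and> y \<in> T} = UNIV"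

lemma outer_product_nth: "outer_product b c $ i $ k = b $ i * c $ k"
  by (simp add: outer_product_def columnvector_def rowvector_def matrix_matrix_mult_def)

end

theory Submission
  imports Defs
begin

text \<open>
  Let \<open>K\<^sub>n\<close> be the space of vectors annihilated by all words of length \<open>n\<close> in \<open>A\<close>, an increasing
  filtration of \<open>k\<^sup>d\<close> by \<open>A\<close>-invariant subspaces that starts with \<open>0\<close> and, by joint nilpotency,
  reaches \<open>k\<^sup>d\<close>. Let \<open>S \<noteq> 0\<close>. If \<open>n\<close> is the last index with \<open>S \<inter> K\<^sub>n = 0\<close>, then \<open>K\<^sub>n\<close> is a complement of \<open>S\<close>.
  Otherwise let \<open>m \<ge> n\<close> be the last index with \<open>S + K\<^sub>m \<noteq> k\<^sup>d\<close>, and let \<open>\<phi> \<noteq> 0\<close> be a functional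
  vanishing on \<open>S + K\<^sub>m\<close>. If \<open>\<phi>(b\<^sub>j) = 0\<close> for all \<open>j\<close>, then \<open>\<phi> A\<^sub>j = \<phi> A'\<^sub>j\<close> vanishes on
  \<open>S + K\<^bsub>m+1\<^esub> = k\<^sup>d\<close>, so that \<open>ker \<phi>\<close> is a proper \<open>A\<close>-invariant subspace containing all \<open>b\<^sub>j\<close>.
  If \<open>\<phi>(b\<^sub>j) \<noteq> 0\<close>, then \<open>0 = \<phi>(A'\<^sub>j s) = \<phi>(b\<^sub>j) c\<^sup>t s\<close> for every \<open>s \<in> S \<inter> K\<^bsub>n+1\<^esub>\<close>; hence
  \<open>A\<^sub>i s = A'\<^sub>i s \<in> S \<inter> K\<^sub>n = 0\<close> for all \<open>i\<close>, and \<open>s = 0\<close> by the condition on \<open>c\<close>, against the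
  choice of \<open>n\<close>.
\<close>

text \<open>A bilinear pairing: vectors serve as functionals \<open>scalar_prod x\<close>, and
  \<open>transpose\<close> gives the adjoint.\<close>

definition scalar_prod :: "'k::field ^ 'd \<Rightarrow> 'k ^ 'd \<Rightarrow> 'k"
  where "scalar_prod x y = (\<Sum>i\<in>UNIV. x $ i * y $ i)"

lemma scalar_prod_add_right: "scalar_prod x (y + z) = scalar_prod x y + scalar_prod x z"
  by (simp add: scalar_prod_def algebra_simps sum.distrib)

lemma scalar_prod_scale_right: "scalar_prod x (a *s y) = a * scalar_prod x y"
  by (simp add: scalar_prod_def algebra_simps sum_distrib_left)

lemma scalar_prod_commute: "scalar_prod x y = scalar_prod y x"
  by (simp add: scalar_prod_def mult.commute)

lemma scalar_prod_zero_right [simp]: "scalar_prod x 0 = 0"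
  by (simp add: scalar_prod_def)

lemma scalar_prod_transpose: "scalar_prod (transpose M *v x) y = scalar_prod x (M *v y)"
proof -
  have "scalar_prod (transpose M *v x) y = (\<Sum>i\<in>UNIV. \<Sum>k\<in>UNIV. M $ k $ i * x $ k * y $ i)"
    by (simp add: scalar_prod_def matrix_vector_mult_def transpose_def sum_distrib_right)
  also have "\<dots> = (\<Sum>k\<in>UNIV. \<Sum>i\<in>UNIV. M $ k $ i * x $ k * y $ i)"
    by (rule sum.swap)
  also have "\<dots> = scalar_prod x (M *v y)"
    by (simp add: scalar_prod_def matrix_vector_mult_def sum_distrib_left algebra_simps)
  finally show ?thesis .
qed

lemma scalar_prod_axis: "scalar_prod x (axis i 1) = x $ i"
  by (simp add: scalar_prod_def axis_def if_distrib cong: if_cong)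

lemma subspace_scalar_prod_kernel: "vec.subspace {y. scalar_prod x y = 0}"
  by (auto intro!: vec.subspaceI simp: scalar_prod_add_right scalar_prod_scale_right)

text \<open>A basis \<open>B\<close> of \<open>W\<close> stays independent when some
  \<open>a\<close> outside \<open>W\<close> joins it, so a linear map fixes \<open>a\<close> and
  kills \<open>W\<close>. The row of its matrix indexed by a nonzero entry of \<open>a\<close> is
  the functional.\<close>

lemma ex_scalar_prod_vanishing:
  fixes W :: "('k::field ^ 'd) set"
  assumes "vec.subspace W" and "W \<noteq> UNIV"
  obtains x where "x \<noteq> 0" and "\<forall>y\<in>W. scalar_prod x y = 0"
proof -
  obtain a where a: "a \<notin> W" using assms(2) by blast
  obtain B where B: "B \<subseteq> W" "vec.independent B" "W \<subseteq> vec.span B"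
    by (rule vec.maximal_independent_subset)
  have span: "vec.span B = W"
    using B assms(1) vec.span_minimal by blast
  have indep: "vec.independent (insert a B)"
    using a B(2) span vec.independent_insertI by blast
  obtain g where g: "Vector_Spaces.linear (*s) (*s) g"
      and g_ext: "\<forall>y\<in>insert a B. g y = (if y = a then a else 0)"
    using vec.linear_independent_extend[OF indep, of "\<lambda>y. if y = a then a else 0"] by blast
  have g_row: "scalar_prod (matrix g $ i) y = g y $ i" for i y
  proof -
    have "scalar_prod (matrix g $ i) y = (matrix g *v y) $ i"
      by (simp add: scalar_prod_def matrix_vector_mult_def)
    then show ?thesis by (simp only: matrix_works[OF g])
  qed
  have g_W: "g y = 0" if "y \<in> W" for y
  proof (rule vec.linear_eq_0_on_span[OF g, of B])
    show "g z = 0" if "z \<in> B" for z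
      using that B(1) a g_ext by (metis insertCI subsetD)
    show "y \<in> vec.span B" using that span by blast
  qed
  have "a \<noteq> 0" using a vec.subspace_0[OF assms(1)] by blast
  then obtain i where i: "g a $ i \<noteq> 0"
    using g_ext by (auto simp: vec_eq_iff)
  show thesis
  proof
    show "matrix g $ i \<noteq> 0"
      using i g_row[of i a] by (auto simp: scalar_prod_def)
    show "\<forall>y\<in>W. scalar_prod (matrix g $ i) y = 0"
      by (simp add: g_row g_W)
  qed
qed

lemma outer_product_mult_vec: "outer_product b c *v x = scalar_prod c x *s b"
  by (simp add: vec_eq_iff matrix_vector_mult_def outer_product_nth scalar_prod_def
      sum_distrib_right sum_distrib_left algebra_simps)

definition word_kernel :: "('g::finite \<Rightarrow> 'k::field ^ 'd ^ 'd) \<Rightarrow> nat \<Rightarrow> ('k ^ 'd) set"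
  where "word_kernel A n = {v. \<forall>w. length w = n \<longrightarrow> word_product A w *v v = 0}"

lemma word_product_Cons: "word_product A (j # w) = A j ** word_product A w"
  by (simp add: word_product_def)

lemma word_product_snoc: "word_product A (w @ [j]) = word_product A w ** A j"
proof (induction w)
  case Nil
  show ?case by (simp add: word_product_def)
next
  case (Cons i w)
  then show ?case by (simp add: word_product_Cons matrix_mul_assoc)
qed

lemma word_kernel_0: "word_kernel A 0 = {0}"
  by (auto simp: word_kernel_def word_product_def)

lemma subspace_word_kernel: "vec.subspace (word_kernel A n)"
  by (auto intro!: vec.subspaceI
      simp: word_kernel_def matrix_vector_right_distrib vec.scale)

text \<open>The last letter of a word acts on \<open>v\<close> first, so it is the one split
  off.\<close>

lemma word_kernel_Suc:
  fixes A :: "'g::finite \<Rightarrow> 'k::field ^ 'd ^ 'd"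
  shows "v \<in> word_kernel A (Suc n) \<longleftrightarrow> (\<forall>j. A j *v v \<in> word_kernel A n)"
proof
  assume v: "v \<in> word_kernel A (Suc n)"
  show "\<forall>j. A j *v v \<in> word_kernel A n"
    using v by (auto simp: word_kernel_def matrix_vector_mul_assoc simp flip: word_product_snoc)
next
  assume v: "\<forall>j. A j *v v \<in> word_kernel A n"
  show "v \<in> word_kernel A (Suc n)"
    unfolding word_kernel_def
  proof (intro CollectI allI impI)
    fix w :: "'g list" assume "length w = Suc n"
    then obtain w' j where w: "w = w' @ [j]" "length w' = n"
      by (metis length_Suc_conv_rev)
    with v show "word_product A w *v v = 0"
      by (simp add: word_kernel_def word_product_snoc flip: matrix_vector_mul_assoc)
  qed
qed

text \<open>Here the first letter is split off: the rest of the word already kills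
  \<open>v\<close>.\<close>

lemma word_kernel_Suc_mono:
  fixes A :: "'g::finite \<Rightarrow> 'k::field ^ 'd ^ 'd"
  shows "word_kernel A n \<subseteq> word_kernel A (Suc n)"
proof
  fix v assume v: "v \<in> word_kernel A n"
  show "v \<in> word_kernel A (Suc n)"
    unfolding word_kernel_def
  proof (intro CollectI allI impI)
    fix w :: "'g list" assume "length w = Suc n"
    with v show "word_product A w *v v = 0"
      by (auto simp: length_Suc_conv word_kernel_def word_product_Cons
          simp flip: matrix_vector_mul_assoc)
  qed
qed

lemma word_kernel_mono: "m \<le> n \<Longrightarrow> word_kernel A m \<subseteq> word_kernel A n"
  by (rule lift_Suc_mono_le[of "word_kernel A"]) (rule word_kernel_Suc_mono)

lemma invariant_word_kernel: "invariant_subspace A (word_kernel A n)"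
  using word_kernel_Suc_mono[of A n] subspace_word_kernel[of A n]
  by (auto simp: invariant_subspace_def word_kernel_Suc)

text \<open>If \<open>P\<close> never switched off, induction from \<open>m\<close> would carry it
  to \<open>n\<close>. Monotonicity of \<open>P\<close> is not assumed.\<close>

lemma ex_last_index:
  assumes "P (m::nat)" and "\<not> P n" and "m \<le> n"
  obtains k where "m \<le> k" and "P k" and "\<not> P (Suc k)"
proof -
  have "\<exists>k\<ge>m. P k \<and> \<not> P (Suc k)"
  proof (rule ccontr)
    assume none: "\<not> ?thesis"
    have "P k" if "m \<le> k" for k
      using that assms(1) none by (induction rule: dec_induct) auto
    with assms show False by blast
  qed
  then show thesis using that by blast
qed

theorem theorem4:
  fixes A A' :: "'g::finite \<Rightarrow> ('k::{alg_closed_field, field_char_0}) ^ 'd::finite ^ 'd"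
    and S :: "('k ^ 'd) set"
  assumes "jointly_nilpotent A"
    and "nondegenerate_right_rank_one_perturbation A A'"
    and "invariant_subspace A' S"
  shows "\<exists>T. complementary_subspaces S T \<and> invariant_subspace A T"
proof -
  let ?K = "word_kernel A"
  let ?sum = "\<lambda>n. {x + y | x y. x \<in> S \<and> y \<in> ?K n}"
  obtain N where N: "?K N = UNIV"
  proof -
    from assms(1) obtain N where "\<forall>w. length w = N \<longrightarrow> word_product A w = 0"
      unfolding jointly_nilpotent_def ..
    then have "?K N = UNIV" by (simp add: word_kernel_def)
    then show thesis by (rule that)
  qed
  obtain b c where bc: "\<forall>j. A' j = A j + outer_product (b j) c"
      "\<not> (\<exists>T. invariant_subspace A T \<and> T \<noteq> UNIV \<and> range b \<subseteq> T)"
      "\<not> (\<exists>T. invariant_subspace (\<lambda>j. transpose (A j)) T \<and> T \<noteq> UNIV \<and> c \<in> T)"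
    using assms(2) unfolding nondegenerate_right_rank_one_perturbation_def by (elim exE conjE)
  have A': "A' j = A j + outer_product (b j) c" for j
    using bc(1) by simp
  have b: "T = UNIV" if "invariant_subspace A T" "range b \<subseteq> T" for T
    using bc(2) that by auto
  have c: "T = UNIV" if "invariant_subspace (\<lambda>j. transpose (A j)) T" "c \<in> T" for T
    using bc(3) that by auto
  have A'_vec: "A' j *v v = A j *v v + scalar_prod c v *s b j" for j v
    by (simp add: A' matrix_vector_mult_add_rdistrib outer_product_mult_vec)
  have S: "vec.subspace S" and S_inv: "\<And>j v. v \<in> S \<Longrightarrow> A' j *v v \<in> S"
    using assms(3) by (auto simp: invariant_subspace_def)
  have S0: "0 \<in> S" by (rule vec.subspace_0[OF S])
  have K0: "0 \<in> ?K n" for n by (rule vec.subspace_0[OF subspace_word_kernel])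

  \<comment> \<open>Non-degeneracy of \<open>b\<close>, applied to the kernel of \<open>x\<close>;
    it is invariant because it contains the range of every \<open>A j\<close>.\<close>
  have b_functional: "x = 0"
    if xb: "\<And>j. scalar_prod x (b j) = 0" and xA: "\<And>j v. scalar_prod x (A j *v v) = 0" for x
  proof -
    have "{y. scalar_prod x y = 0} = UNIV"
      using xb xA by (intro b) (auto simp: invariant_subspace_def subspace_scalar_prod_kernel)
    then have "scalar_prod x (axis i 1) = 0" for i by blast
    then show ?thesis by (simp add: scalar_prod_axis vec_eq_iff)
  qed
  \<comment> \<open>The dual statement: as \<open>A j\<close> kills \<open>s\<close>, pairing with
    \<open>s\<close> vanishes on the range of each transpose.\<close>
  have c_vector: "s = 0" if cs: "scalar_prod c s = 0" and As: "\<And>j. A j *v s = 0" for s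
  proof -
    have "{x. scalar_prod s x = 0} = UNIV"
    proof (rule c)
      have "scalar_prod s (transpose (A j) *v x) = 0" for j x
      proof -
        have "scalar_prod s (transpose (A j) *v x) = scalar_prod x (A j *v s)"
          by (simp only: scalar_prod_commute[of s] scalar_prod_transpose)
        then show ?thesis by (simp only: As scalar_prod_zero_right)
      qed
      then show "invariant_subspace (\<lambda>j. transpose (A j)) {x. scalar_prod s x = 0}"
        by (simp add: invariant_subspace_def subspace_scalar_prod_kernel)
      show "c \<in> {x. scalar_prod s x = 0}"
        using cs by (simp add: scalar_prod_commute)
    qed
    then have "scalar_prod s (axis i 1) = 0" for i by blast
    then show ?thesis by (simp add: scalar_prod_axis vec_eq_iff)
  qed

  have "\<exists>n. S \<inter> ?K n = {0} \<and> ?sum n = UNIV"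
  proof (cases "S = {0}")
    case True
    \<comment> \<open>For \<open>S = {0}\<close> the intersection is trivial at every level, so no
      last index exists; \<open>N\<close> serves directly.\<close>
    then have "S \<inter> ?K N = {0} \<and> ?sum N = UNIV" using N by auto
    then show ?thesis by blast
  next
    case False
    have "S \<inter> ?K 0 = {0}" "S \<inter> ?K N \<noteq> {0}"
      using False N S0 by (auto simp: word_kernel_0)
    from this le0 obtain n where n: "S \<inter> ?K n = {0}" and Suc_n: "S \<inter> ?K (Suc n) \<noteq> {0}"
      by (rule ex_last_index[where P = "\<lambda>n. S \<inter> ?K n = {0}"])
    have "?sum n = UNIV"
    proof (rule ccontr)
      assume sum_n: "?sum n \<noteq> UNIV"
      have sum_N: "\<not> ?sum N \<noteq> UNIV" using N S0 by force
      have "n \<le> N"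
      proof (rule ccontr)
        assume "\<not> n \<le> N"
        then have "?K n = UNIV" using word_kernel_mono[of N n A] N by auto
        with n False show False by simp
      qed
      from sum_n sum_N this
      obtain m where m: "n \<le> m" "?sum m \<noteq> UNIV" "\<not> ?sum (Suc m) \<noteq> UNIV"
        by (rule ex_last_index[where P = "\<lambda>m. ?sum m \<noteq> UNIV"])
      have "vec.subspace (?sum m)"
        by (rule vec.subspace_sums[OF S subspace_word_kernel])
      then obtain x where x: "x \<noteq> 0" "\<forall>y\<in>?sum m. scalar_prod x y = 0"
        using m(2) by (rule ex_scalar_prod_vanishing)
      have x_S: "scalar_prod x y = 0" if "y \<in> S" for y
        using that K0[of m] by (intro bspec[OF x(2)]) force
      have x_K: "scalar_prod x y = 0" if "y \<in> ?K m" for y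
        using that S0 by (intro bspec[OF x(2)]) force
      have "\<exists>j. scalar_prod x (b j) \<noteq> 0"
      proof (rule ccontr)
        assume "\<not> ?thesis"
        then have xb: "scalar_prod x (b j) = 0" for j by blast
        have "scalar_prod x (A j *v v) = 0" for j v
        proof -
          have "v \<in> ?sum (Suc m)" using m(3) by simp
          then obtain s t where v: "v = s + t" "s \<in> S" "t \<in> ?K (Suc m)" by blast
          \<comment> \<open>By \<open>xb\<close>, the functional \<open>x\<close> does not see the
            rank-one term.\<close>
          have "scalar_prod x (A j *v s) = scalar_prod x (A' j *v s)"
            by (simp add: A'_vec scalar_prod_add_right scalar_prod_scale_right xb)
          then show ?thesis
            using v x_S[OF S_inv[OF v(2)]] x_K
            by (simp add: matrix_vector_right_distrib scalar_prod_add_right word_kernel_Suc)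
        qed
        with xb x(1) show False using b_functional[of x] by blast
      qed
      then obtain j where j: "scalar_prod x (b j) \<noteq> 0" by blast
      have "s = 0" if s: "s \<in> S" "s \<in> ?K (Suc n)" for s
      proof (rule c_vector)
        have As: "A i *v s \<in> ?K n" for i
          using s(2) by (simp add: word_kernel_Suc)
        \<comment> \<open>This uses \<open>n \<le> m\<close>: \<open>A j *v s\<close> lies in
          \<open>?K n\<close>, hence in \<open>?K m\<close>, where \<open>x\<close>
          vanishes.\<close>
        have "scalar_prod x (A j *v s) = 0"
          using As word_kernel_mono[OF m(1)] x_K by blast
        then show cs: "scalar_prod c s = 0"
          using x_S[OF S_inv[OF s(1), of j]] j
          by (simp add: A'_vec scalar_prod_add_right scalar_prod_scale_right)
        show "A i *v s = 0" for i
        proof -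
          have "A i *v s \<in> S" using S_inv[OF s(1), of i] cs by (simp add: A'_vec)
          with As[of i] n show ?thesis by blast
        qed
      qed
      with Suc_n S0 K0 show False by blast
    qed
    with n show ?thesis by blast
  qed
  then show ?thesis
    using S subspace_word_kernel invariant_word_kernel
    unfolding complementary_subspaces_def by blast
qed

end
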